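(* Let $\mathcal{P}=\{f_1,\ldots,f_n\}\subset\mathbb{D}\{U\}$ be a system of linear differential polynomials satisfying the standing assumptions $(\mathcal{P}1)$–$(\mathcal{P}4)$. If $\mathcal{P}$ is super essential, then the matrix $\mathcal{M}(\mathcal{P})$ has no zero columns.
   Context: Let $\mathbb{D}$ be an ordinary differential domain with derivation $\partial$, $n\ge 2$, and $U=\{u_1,\ldots,u_{n-1}\}$ a set of differential indeterminates over $\mathbb{D}$. Write $u_{j,k}=\partial^k u_j$ ($u_{j,0}=u_j$), $\mathbb{D}\{U\}=\mathbb{D}[u_{j,k}\mid j=1,\ldots,n-1,\ k\in\mathbb{N}_0]$ for the ring of differential polynomials, and $\mathbb{D}[\partial]$ for the ring of linear differential operators with coefficients in $\mathbb{D}$. The order of $f\in\mathbb{D}\{U\}$ is the largest $k$ such that some $u_{j,k}$ occurs in $f$ ($-1$ if none occurs). System: $\mathcal{P}=\{f_1,\ldots,f_n\}$ with $f_i=a_i+\sum_{j=1}^{n-1}\mathcal{L}_{i,j}(u_j)$, $a_i\in\mathbb{D}$, $\mathcal{L}_{i,j}\in\mathbb{D}[\partial]$. Standing assumptions: $(\mathcal{P}1)$ the order of $f_i$ is $o_i\ge 0$ for every $i$ (so no $f_i$ lies in $\mathbb{D}$); $(\mathcal{P}2)$ the $n$ polynomials are distinct; $(\mathcal{P}3)$ $a_i\neq 0$ for some $i$; $(\mathcal{P}4)$ for every $j\in\{1,\ldots,n-1\}$ there is $i$ with $\mathcal{L}_{i,j}\neq 0$. Super essential: for every $i\in\{1,\ldots,n\}$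 there is a permutation $\tau_i$ of $\{1,\ldots,n-1\}$ such that $\mathcal{L}_{j,\tau_i(n-j)}\neq 0$ for $j=1,\ldots,i-1$ and $\mathcal{L}_{j,\tau_i(n-j+1)}\neq 0$ for $j=i+1,\ldots,n$. For a nonzero operator $\mathcal{L}=\sum_k\alpha_k\partial^k$, let $\deg(\mathcal{L})=\max\{k\mid\alpha_k\neq0\}$ and $\mathrm{ldeg}(\mathcal{L})=\min\{k\mid\alpha_k\neq 0\}$. For $j=1,\ldots,n-1$ put $\overline{\gamma}_j=\min\{o_i-\deg(\mathcal{L}_{i,j})\mid \mathcal{L}_{i,j}\neq0,\ i=1,\ldots,n\}$, $\underline{\gamma}_j=\min\{\mathrm{ldeg}(\mathcal{L}_{i,j})\mid\mathcal{L}_{i,j}\neq 0,\ i=1,\ldots,n\}$, $\gamma_j=\underline{\gamma}_j+\overline{\gamma}_j$, and $\gamma=\sum_{j=1}^{n-1}\gamma_j$. Let $N=\sum_{i=1}^n o_i$. When $N-o_i-\gamma\ge 0$ for all $i$ (this is the case for super essential systems), set $\mathrm{ps}(\mathcal{P})=\{\partial^k f_i\mid 0\le k\le N-o_i-\gamma,\ i=1,\ldots,n\}$, with $L=\sum_{i=1}^n(N-o_i-\gamma+1)$ elements, and $\mathcal{V}=\{u_{j,k}\mid \underline{\gamma}_j\le k\le N-\overline{\gamma}_j-\gamma,\ j=1,\ldots,n-1\}$, with $L-1$ elements; one has $\mathrm{ps}(\mathcal{P})\subset\mathbb{D}[\mathcal{V}]$. The matrix $\mathcal{M}(\mathcal{P})$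 is the $L\times L$ coefficient matrix of the elements of $\mathrm{ps}(\mathcal{P})$ as polynomials of degree at most one in $\mathbb{D}[\mathcal{V}]$: its rows are indexed by $\mathrm{ps}(\mathcal{P})$, and its columns by the elements of $\mathcal{V}$ followed by $1$ (the last column contains the terms $\partial^k a_i$). *)

theory Defs
  imports
    "HOL-Library.Poly_Mapping"
    "HOL-Computational_Algebra.Polynomial"
    "HOL-Combinatorics.Permutations"
    "Jordan_Normal_Form.Matrix"
begin

definition derivation :: "('r::comm_ring_1 \<Rightarrow> 'r) \<Rightarrow> bool" where
  "derivation \<delta> \<longleftrightarrow> (\<forall>x y. \<delta> (x + y) = \<delta> x + \<delta> y) \<and> (\<forall>x y. \<delta> (x * y) = \<delta> x * y + x * \<delta> y)"

text \<open>
  Differential polynomials over \<open>'a\<close>: the pair \<open>(j, k)\<close> is the indeterminate \<open>u_{j,k}\<close>,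
  a monomial is a finitely supported exponent map, a polynomial is a finitely supported
  coefficient map on monomials.  The multiplication is the convolution product of
  \<open>Poly_Mapping\<close>.  The type provides indeterminates for every \<open>j\<close>; a system of \<open>n\<close>
  polynomials only involves those with \<open>1 \<le> j \<le> n - 1\<close>.
\<close>

type_synonym dmonom = "(nat \<times> nat) \<Rightarrow>\<^sub>0 nat"
type_synonym 'a dpoly = "dmonom \<Rightarrow>\<^sub>0 'a"

definition dvar_monom :: "nat \<times> nat \<Rightarrow> dmonom" where
  "dvar_monom v = Poly_Mapping.single v 1"

definition dconst :: "'a \<Rightarrow> ('a::comm_ring_1) dpoly" where
  "dconst c = Poly_Mapping.single 0 c"

definition dvar :: "nat \<Rightarrow> nat \<Rightarrow> ('a::comm_ring_1) dpoly" where
  "dvar j k = Poly_Mapping.single (dvar_monom (j, k)) 1"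

text \<open>
  The derivation of the ring of differential polynomials which extends \<open>\<delta>\<close> and maps
  \<open>u_{j,k}\<close> to \<open>u_{j,k+1}\<close>, first on a term \<open>c m\<close>: the sum is
  \<open>c \<Sum>\<^sub>v (\<partial>m/\<partial>v) \<partial>v\<close>.  See \<open>derivation_dderiv\<close>, \<open>dderiv_dconst\<close> and \<open>dderiv_dvar\<close> below.
\<close>

definition dderiv_term :: "('a \<Rightarrow> 'a) \<Rightarrow> dmonom \<Rightarrow> 'a \<Rightarrow> ('a::comm_ring_1) dpoly" where
  "dderiv_term \<delta> m c = Poly_Mapping.single m (\<delta> c) +
     (\<Sum>(j, k) \<in> Poly_Mapping.keys m.
        Poly_Mapping.single (m - dvar_monom (j, k) + dvar_monom (j, Suc k))
          (of_nat (Poly_Mapping.lookup m (j, k)) * c))"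

definition dderiv :: "('a \<Rightarrow> 'a) \<Rightarrow> ('a::comm_ring_1) dpoly \<Rightarrow> 'a dpoly" where
  "dderiv \<delta> p = (\<Sum>m \<in> Poly_Mapping.keys p. dderiv_term \<delta> m (Poly_Mapping.lookup p m))"

definition dvars :: "('a::comm_ring_1) dpoly \<Rightarrow> (nat \<times> nat) set" where
  "dvars p = (\<Union>m \<in> Poly_Mapping.keys p. Poly_Mapping.keys m)"

definition dorder :: "('a::comm_ring_1) dpoly \<Rightarrow> int" where
  "dorder p = (if dvars p = {} then -1 else int (Max (snd ` dvars p)))"

text \<open>
  A linear differential operator \<open>\<Sum>\<^sub>k \<alpha>\<^sub>k \<partial>\<^sup>k\<close> is given by its coefficient sequence, stored in
  \<open>'a poly\<close>; its degree is \<^const>\<open>Polynomial.degree\<close>.  Composition of operators, which is not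
  the multiplication of \<open>'a poly\<close>, plays no role.
\<close>

definition op_apply :: "('a \<Rightarrow> 'a) \<Rightarrow> 'a poly \<Rightarrow> ('a::comm_ring_1) dpoly \<Rightarrow> 'a dpoly" where
  "op_apply \<delta> P p = (\<Sum>k\<le>Polynomial.degree P. dconst (poly.coeff P k) * (dderiv \<delta> ^^ k) p)"

definition ldeg :: "('a::zero) poly \<Rightarrow> nat" where
  "ldeg P = (LEAST k. poly.coeff P k \<noteq> 0)"

text \<open>
  A system is given by the \<open>a i\<close> and the operators \<open>L i j\<close> for \<open>i \<in> {1..n}\<close>, \<open>j \<in> {1..n-1}\<close>.
\<close>

definition sys_poly :: "('a \<Rightarrow> 'a) \<Rightarrow> nat \<Rightarrow> (nat \<Rightarrow> 'a) \<Rightarrow> (nat \<Rightarrow> nat \<Rightarrow> 'a poly) \<Rightarrow> nat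
    \<Rightarrow> ('a::comm_ring_1) dpoly" where
  "sys_poly \<delta> n a L i = dconst (a i) + (\<Sum>j = 1..n-1. op_apply \<delta> (L i j) (dvar j 0))"

definition sys_order :: "('a \<Rightarrow> 'a) \<Rightarrow> nat \<Rightarrow> (nat \<Rightarrow> 'a) \<Rightarrow> (nat \<Rightarrow> nat \<Rightarrow> ('a::comm_ring_1) poly)
    \<Rightarrow> nat \<Rightarrow> int" where
  "sys_order \<delta> n a L i = dorder (sys_poly \<delta> n a L i)"

definition super_essential :: "nat \<Rightarrow> (nat \<Rightarrow> nat \<Rightarrow> ('a::zero) poly) \<Rightarrow> bool" where
  "super_essential n L \<longleftrightarrow>
     (\<forall>i\<in>{1..n}. \<exists>\<tau>. \<tau> permutes {1..n-1} \<and>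
        (\<forall>j\<in>{1..<i}. L j (\<tau> (n - j)) \<noteq> 0) \<and>
        (\<forall>j\<in>{i<..n}. L j (\<tau> (n - j + 1)) \<noteq> 0))"

definition gamma_upper :: "('a \<Rightarrow> 'a) \<Rightarrow> nat \<Rightarrow> (nat \<Rightarrow> 'a) \<Rightarrow> (nat \<Rightarrow> nat \<Rightarrow> ('a::comm_ring_1) poly)
    \<Rightarrow> nat \<Rightarrow> int" where
  "gamma_upper \<delta> n a L j =
     Min {sys_order \<delta> n a L i - int (Polynomial.degree (L i j)) | i. L i j \<noteq> 0 \<and> i \<in> {1..n}}"

definition gamma_lower :: "nat \<Rightarrow> (nat \<Rightarrow> nat \<Rightarrow> ('a::zero) poly) \<Rightarrow> nat \<Rightarrow> int" where
  "gamma_lower n L j = Min {int (ldeg (L i j)) | i. L i j \<noteq> 0 \<and> i \<in> {1..n}}"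

definition gamma_at :: "('a \<Rightarrow> 'a) \<Rightarrow> nat \<Rightarrow> (nat \<Rightarrow> 'a) \<Rightarrow> (nat \<Rightarrow> nat \<Rightarrow> ('a::comm_ring_1) poly)
    \<Rightarrow> nat \<Rightarrow> int" where
  "gamma_at \<delta> n a L j = gamma_lower n L j + gamma_upper \<delta> n a L j"

definition gamma :: "('a \<Rightarrow> 'a) \<Rightarrow> nat \<Rightarrow> (nat \<Rightarrow> 'a) \<Rightarrow> (nat \<Rightarrow> nat \<Rightarrow> ('a::comm_ring_1) poly) \<Rightarrow> int" where
  "gamma \<delta> n a L = (\<Sum>j = 1..n-1. gamma_at \<delta> n a L j)"

definition sum_orders :: "('a \<Rightarrow> 'a) \<Rightarrow> nat \<Rightarrow> (nat \<Rightarrow> 'a) \<Rightarrow> (nat \<Rightarrow> nat \<Rightarrow> ('a::comm_ring_1) poly)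
    \<Rightarrow> int" where
  "sum_orders \<delta> n a L = (\<Sum>i = 1..n. sys_order \<delta> n a L i)"

text \<open>
  The derivatives in \<open>ps(\<P>)\<close> are listed as a family indexed by \<open>(i, k)\<close>, so that there is one
  row for each \<open>(i, k)\<close> even if two of these derivatives coincide.
\<close>

definition ps_list :: "('a \<Rightarrow> 'a) \<Rightarrow> nat \<Rightarrow> (nat \<Rightarrow> 'a) \<Rightarrow> (nat \<Rightarrow> nat \<Rightarrow> ('a::comm_ring_1) poly)
    \<Rightarrow> 'a dpoly list" where
  "ps_list \<delta> n a L = concat (map (\<lambda>i.
     map (\<lambda>k. (dderiv \<delta> ^^ nat k) (sys_poly \<delta> n a L i))
       [0 .. sum_orders \<delta> n a L - sys_order \<delta> n a L i - gamma \<delta> n a L]) [1..<Suc n])"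

definition var_list :: "('a \<Rightarrow> 'a) \<Rightarrow> nat \<Rightarrow> (nat \<Rightarrow> 'a) \<Rightarrow> (nat \<Rightarrow> nat \<Rightarrow> ('a::comm_ring_1) poly)
    \<Rightarrow> (nat \<times> nat) list" where
  "var_list \<delta> n a L = concat (map (\<lambda>j.
     map (\<lambda>k. (j, nat k))
       [gamma_lower n L j .. sum_orders \<delta> n a L - gamma_upper \<delta> n a L j - gamma \<delta> n a L]) [1..<n])"

text \<open>
  The last column is the one of the monomial \<open>1\<close>, which is the exponent map \<open>0\<close>.
\<close>

definition M_cols :: "('a \<Rightarrow> 'a) \<Rightarrow> nat \<Rightarrow> (nat \<Rightarrow> 'a) \<Rightarrow> (nat \<Rightarrow> nat \<Rightarrow> ('a::comm_ring_1) poly)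
    \<Rightarrow> dmonom list" where
  "M_cols \<delta> n a L = map dvar_monom (var_list \<delta> n a L) @ [0]"

definition M_mat :: "('a \<Rightarrow> 'a) \<Rightarrow> nat \<Rightarrow> (nat \<Rightarrow> 'a) \<Rightarrow> (nat \<Rightarrow> nat \<Rightarrow> ('a::comm_ring_1) poly) \<Rightarrow> 'a mat" where
  "M_mat \<delta> n a L = mat (length (ps_list \<delta> n a L)) (length (M_cols \<delta> n a L))
     (\<lambda>(r, c). Poly_Mapping.lookup (ps_list \<delta> n a L ! r) (M_cols \<delta> n a L ! c))"

definition L_size :: "('a \<Rightarrow> 'a) \<Rightarrow> nat \<Rightarrow> (nat \<Rightarrow> 'a) \<Rightarrow> (nat \<Rightarrow> nat \<Rightarrow> ('a::comm_ring_1) poly) \<Rightarrow> int" where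
  "L_size \<delta> n a L = (\<Sum>i = 1..n. sum_orders \<delta> n a L - sys_order \<delta> n a L i - gamma \<delta> n a L + 1)"

text \<open>\<^const>\<open>dderiv\<close> is the derivation it is meant to be.\<close>

lemma derivation_0: "derivation \<delta> \<Longrightarrow> \<delta> 0 = 0"
  unfolding derivation_def by (metis add_cancel_right_left add_0)

lemma derivation_1: "derivation \<delta> \<Longrightarrow> \<delta> 1 = 0"
  unfolding derivation_def by (metis add_cancel_right_left mult_1 mult_1_right)

lemma dderiv_term_0: "derivation \<delta> \<Longrightarrow> dderiv_term \<delta> m 0 = 0"
  by (simp add: dderiv_term_def derivation_0 case_prod_unfold)

lemma dderiv_term_add:
  "derivation \<delta> \<Longrightarrow> dderiv_term \<delta> m (c + d) = dderiv_term \<delta> m c + dderiv_term \<delta> m d"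
  by (simp add: dderiv_term_def derivation_def single_add case_prod_unfold sum.distrib algebra_simps)

lemma dderiv_superset:
  assumes "derivation \<delta>" "finite A" "Poly_Mapping.keys p \<subseteq> A"
  shows "dderiv \<delta> p = (\<Sum>m\<in>A. dderiv_term \<delta> m (Poly_Mapping.lookup p m))"
  unfolding dderiv_def using assms
  by (intro sum.mono_neutral_left) (auto simp: dderiv_term_0 in_keys_iff)

lemma dderiv_add:
  assumes "derivation \<delta>"
  shows "dderiv \<delta> (p + q) = dderiv \<delta> p + dderiv \<delta> q"
proof -
  let ?A = "Poly_Mapping.keys p \<union> Poly_Mapping.keys q"
  have "Poly_Mapping.keys (p + q) \<subseteq> ?A" by (rule Poly_Mapping.keys_add)
  then show ?thesis
    using dderiv_superset[OF assms, of ?A]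
    by (simp add: lookup_add dderiv_term_add[OF assms] sum.distrib)
qed

lemma dderiv_0: "dderiv \<delta> 0 = 0"
  by (simp add: dderiv_def)

lemma dderiv_sum: "derivation \<delta> \<Longrightarrow> dderiv \<delta> (sum f A) = (\<Sum>x\<in>A. dderiv \<delta> (f x))"
  by (induction A rule: infinite_finite_induct) (auto simp: dderiv_0 dderiv_add)

lemma dderiv_single: "derivation \<delta> \<Longrightarrow> dderiv \<delta> (Poly_Mapping.single m c) = dderiv_term \<delta> m c"
  by (simp add: dderiv_def dderiv_term_0)

lemma dderiv_dconst: "derivation \<delta> \<Longrightarrow> dderiv \<delta> (dconst c) = dconst (\<delta> c)"
  by (simp add: dconst_def dderiv_single dderiv_term_def)

lemma dderiv_dvar: "derivation \<delta> \<Longrightarrow> dderiv \<delta> (dvar j k) = dvar j (Suc k)"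
  by (simp add: dvar_def dderiv_single dderiv_term_def derivation_1 dvar_monom_def)

lemma dpoly_expand:
  "(p :: 'a::comm_ring_1 dpoly) = (\<Sum>m\<in>Poly_Mapping.keys p. Poly_Mapping.single m (Poly_Mapping.lookup p m))"
proof (rule poly_mapping_eqI)
  fix k
  show "Poly_Mapping.lookup p k = Poly_Mapping.lookup
      (\<Sum>m\<in>Poly_Mapping.keys p. Poly_Mapping.single m (Poly_Mapping.lookup p m)) k"
    by (simp add: lookup_sum lookup_single when_def in_keys_iff)
qed

lemma dderiv_term_mult:
  fixes c d :: "'a::comm_ring_1"
  assumes "derivation \<delta>"
  shows "dderiv_term \<delta> (m + m') (c * d) =
    dderiv_term \<delta> m c * Poly_Mapping.single m' d + Poly_Mapping.single m c * dderiv_term \<delta> m' d"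
proof -
  let ?s = "\<lambda>v. dvar_monom (fst v, Suc (snd v))"
  let ?K = "Poly_Mapping.keys m \<union> Poly_Mapping.keys m'"
  define g where "g m v = m - dvar_monom v + ?s v" for m v
  have cancel: "x + y - dvar_monom v = (x - dvar_monom v) + y"
    if "v \<in> Poly_Mapping.keys x" for x y v
    by (rule poly_mapping_eqI)
      (use that in \<open>auto simp: lookup_add lookup_minus dvar_monom_def lookup_single when_def in_keys_iff\<close>)
  have ext: "(\<Sum>v\<in>Poly_Mapping.keys x. Poly_Mapping.single (h v) (of_nat (Poly_Mapping.lookup x v) * e))
     = (\<Sum>v\<in>?K. Poly_Mapping.single (h v) (of_nat (Poly_Mapping.lookup x v) * e))"
    if "Poly_Mapping.keys x \<subseteq> ?K" for x and h :: "nat \<times> nat \<Rightarrow> dmonom" and e :: 'a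
    using that by (intro sum.mono_neutral_left) (auto simp: in_keys_iff)
  have step: "Poly_Mapping.single (g (m + m') v) (of_nat (Poly_Mapping.lookup (m + m') v) * (c * d)) =
      Poly_Mapping.single (g m v + m') (of_nat (Poly_Mapping.lookup m v) * c * d) +
      Poly_Mapping.single (m + g m' v) (c * (of_nat (Poly_Mapping.lookup m' v) * d))" for v
  proof -
    have 1: "Poly_Mapping.single (g (m + m') v) (of_nat (Poly_Mapping.lookup m v) * c * d) =
        Poly_Mapping.single (g m v + m') (of_nat (Poly_Mapping.lookup m v) * c * d)"
    proof (cases "v \<in> Poly_Mapping.keys m")
      case True
      then show ?thesis by (simp add: g_def cancel algebra_simps)
    qed (simp add: in_keys_iff)
    have 2: "Poly_Mapping.single (g (m + m') v) (c * (of_nat (Poly_Mapping.lookup m' v) * d)) =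
        Poly_Mapping.single (m + g m' v) (c * (of_nat (Poly_Mapping.lookup m' v) * d))"
    proof (cases "v \<in> Poly_Mapping.keys m'")
      case True
      then have "m + m' - dvar_monom v = m + (m' - dvar_monom v)"
        using cancel[OF True, of m] by (simp add: add.commute)
      then show ?thesis by (simp add: g_def add.assoc)
    qed (simp add: in_keys_iff)
    show ?thesis
      unfolding 1[symmetric] 2[symmetric] single_add[symmetric]
      by (simp add: lookup_add algebra_simps)
  qed
  have T: "dderiv_term \<delta> x e = Poly_Mapping.single x (\<delta> e) +
      (\<Sum>v\<in>?K. Poly_Mapping.single (g x v) (of_nat (Poly_Mapping.lookup x v) * e))"
    if "Poly_Mapping.keys x \<subseteq> ?K" for x e
    unfolding dderiv_term_def using ext[OF that] by (simp add: case_prod_unfold g_def)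
  have sub: "Poly_Mapping.keys (m + m') \<subseteq> ?K" by (rule Poly_Mapping.keys_add)
  have mul: "\<delta> (c * d) = \<delta> c * d + c * \<delta> d" using assms by (simp add: derivation_def)
  show ?thesis
    unfolding T[OF sub] T[OF Un_upper1] T[OF Un_upper2] mul
    by (simp add: step sum.distrib distrib_left distrib_right sum_distrib_left sum_distrib_right
        mult_single single_add)
qed

lemma derivation_dderiv:
  fixes \<delta> :: "'a::comm_ring_1 \<Rightarrow> 'a"
  assumes "derivation \<delta>"
  shows "derivation (dderiv \<delta>)"
proof -
  have "dderiv \<delta> (p * q) = dderiv \<delta> p * q + p * dderiv \<delta> q" for p q :: "'a dpoly"
  proof -
    let ?l = Poly_Mapping.lookup and ?s = Poly_Mapping.single
    let ?P = "Poly_Mapping.keys p" and ?Q = "Poly_Mapping.keys q"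
    have "p * q = (\<Sum>m\<in>?P. \<Sum>m'\<in>?Q. ?s (m + m') (?l p m * ?l q m'))"
      by (subst dpoly_expand[of p], subst dpoly_expand[of q]) (simp add: sum_product mult_single)
    then have "dderiv \<delta> (p * q) = (\<Sum>m\<in>?P. \<Sum>m'\<in>?Q. dderiv_term \<delta> (m + m') (?l p m * ?l q m'))"
      by (simp add: dderiv_sum[OF assms] dderiv_single[OF assms])
    also have "\<dots> = (\<Sum>m\<in>?P. \<Sum>m'\<in>?Q. dderiv_term \<delta> m (?l p m) * ?s m' (?l q m'))
        + (\<Sum>m\<in>?P. \<Sum>m'\<in>?Q. ?s m (?l p m) * dderiv_term \<delta> m' (?l q m'))"
      by (simp add: dderiv_term_mult[OF assms] sum.distrib)
    also have "\<dots> = dderiv \<delta> p * q + p * dderiv \<delta> q"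
      unfolding sum_product[symmetric] dderiv_def[symmetric] dpoly_expand[symmetric] ..
    finally show ?thesis .
  qed
  then show ?thesis by (simp add: derivation_def[of "dderiv \<delta>"] dderiv_add[OF assms])
qed

text \<open>The matrix is square of the expected size.\<close>

lemma gamma_at_le:
  assumes "L i j \<noteq> 0" "i \<in> {1..n}"
  shows "gamma_at \<delta> n a L j \<le> sys_order \<delta> n a L i"
proof -
  have "gamma_upper \<delta> n a L j \<le> sys_order \<delta> n a L i - int (Polynomial.degree (L i j))"
    unfolding gamma_upper_def using assms by (intro Min_le) auto
  moreover have "gamma_lower n L j \<le> int (ldeg (L i j))"
    unfolding gamma_lower_def using assms by (intro Min_le) auto
  moreover have "ldeg (L i j) \<le> Polynomial.degree (L i j)"
    unfolding ldeg_def using assms by (intro Least_le) (simp add: leading_coeff_neq_0)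
  ultimately show ?thesis by (simp add: gamma_at_def)
qed

lemma M_mat_carrier:
  assumes n: "n \<ge> 2"
    and nn: "\<And>i. i \<in> {1..n} \<Longrightarrow> sum_orders \<delta> n a L - sys_order \<delta> n a L i - gamma \<delta> n a L \<ge> 0"
    and P4: "\<And>j. j \<in> {1..n-1} \<Longrightarrow> \<exists>i\<in>{1..n}. L i j \<noteq> 0"
  shows "M_mat \<delta> n a L \<in> carrier_mat (nat (L_size \<delta> n a L)) (nat (L_size \<delta> n a L))"
proof -
  let ?N = "sum_orders \<delta> n a L" and ?g = "gamma \<delta> n a L"
  have "int (length (ps_list \<delta> n a L)) = (\<Sum>i = 1..n. int (nat (?N - sys_order \<delta> n a L i - ?g + 1)))"
    unfolding ps_list_def length_concat map_map comp_def length_map length_upto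
    by (simp add: interv_sum_list_conv_sum_set_nat atLeastLessThanSuc_atLeastAtMost del: upt_Suc)
  also have "\<dots> = L_size \<delta> n a L"
    unfolding L_size_def using nn by (intro sum.cong) auto
  finally have r: "int (length (ps_list \<delta> n a L)) = L_size \<delta> n a L" .
  have cols: "?N - gamma_upper \<delta> n a L j - ?g - gamma_lower n L j + 1 \<ge> 0" if j: "j \<in> {1..n-1}" for j
  proof -
    obtain i where i: "i \<in> {1..n}" "L i j \<noteq> 0" using P4[OF j] by auto
    show ?thesis using nn[OF i(1)] gamma_at_le[where L = L, OF i(2,1), of \<delta> a] by (simp add: gamma_at_def)
  qed
  have "int (length (var_list \<delta> n a L)) =
      (\<Sum>j = 1..n-1. int (nat (?N - gamma_upper \<delta> n a L j - ?g - gamma_lower n L j + 1)))"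
    unfolding var_list_def length_concat map_map comp_def length_map length_upto using n
    by (cases n) (simp_all add: interv_sum_list_conv_sum_set_nat atLeastLessThanSuc_atLeastAtMost del: upt_Suc)
  also have "\<dots> = (\<Sum>j = 1..n-1. (?N - ?g + 1) - gamma_at \<delta> n a L j)"
    using cols by (intro sum.cong) (auto simp: gamma_at_def)
  also have "\<dots> = (int n - 1) * (?N - ?g + 1) - ?g"
    using n by (simp add: sum_subtractf gamma_def of_nat_diff)
  also have "\<dots> = L_size \<delta> n a L - 1"
  proof -
    have "L_size \<delta> n a L = (\<Sum>i = 1..n. (?N - ?g + 1) - sys_order \<delta> n a L i)"
      unfolding L_size_def by (intro sum.cong) auto
    also have "\<dots> = int n * (?N - ?g + 1) - ?N"
      unfolding sum_subtractf by (simp add: sum_orders_def)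
    finally show ?thesis by (simp add: algebra_simps)
  qed
  finally have c: "int (length (M_cols \<delta> n a L)) = L_size \<delta> n a L" by (simp add: M_cols_def)
  have "length (M_cols \<delta> n a L) = length (ps_list \<delta> n a L)" using r c by linarith
  then show ?thesis unfolding M_mat_def r[symmetric] by simp
qed

end

theory Submission
  imports Defs
begin

text \<open>
  Fix \<open>j\<close>, and put \<open>T\<^sub>i = N - o\<^sub>i - \<gamma>\<close>.  Since
  \<open>c\<^sub>t\<^sub>+\<^sub>1\<^sub>,\<^sub>k = \<delta> c\<^sub>t\<^sub>,\<^sub>k + c\<^sub>t\<^sub>,\<^sub>k\<^sub>-\<^sub>1\<close> for the coefficient \<open>c\<^sub>t\<^sub>,\<^sub>k\<close> of \<open>u_{j,k}\<close>
  in \<open>\<partial>\<^sup>t f\<^sub>i\<close>, a nonzero coefficient of \<open>L\<^sub>i\<^sub>,\<^sub>j\<close> at \<open>m\<close> makes the columns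
  \<open>m, \<dots>, m + T\<^sub>i\<close> nonzero, in any characteristic.  Let \<open>x\<close> attain the minimum defining the
  lower \<open>\<gamma>\<^sub>j\<close> and \<open>y\<close> the one defining the upper \<open>\<gamma>\<^sub>j\<close>.  The rows of \<open>f\<^sub>x\<close> cover the low
  columns and those of \<open>f\<^sub>y\<close> the high ones.  Deleting the row \<open>x\<close> (or \<open>y\<close>) leaves a perfect
  matching, and the row \<open>g\<close> (or \<open>h\<close>) which it assigns to \<open>j\<close> satisfies
  \<open>o\<^sub>g - \<gamma>\<^sub>j \<le> T\<^sub>x\<close> (or \<open>o\<^sub>h - \<gamma>\<^sub>j \<le> T\<^sub>y\<close>).  The rows of \<open>f\<^sub>g\<close> and \<open>f\<^sub>h\<close> then cover
  whatever is left in between.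
\<close>

lemma dvar_monom_eq_iff: "dvar_monom v = dvar_monom w \<longleftrightarrow> v = w"
  unfolding dvar_monom_def by (metis keys_single one_neq_zero singleton_inject)

lemma dvar_monom_neq_0: "dvar_monom v \<noteq> 0"
  unfolding dvar_monom_def by (metis keys_single keys_zero one_neq_zero insert_not_empty)

text \<open>Replacing one factor \<open>v\<close> of \<open>m\<close> by \<open>w\<close> preserves
  the total degree, so such a shift is linear only if \<open>m\<close> is. Membership of
  \<open>v\<close> in the keys makes the truncated subtraction exact.\<close>

lemma monom_shift_eq_dvar_monom_iff:
  assumes "v \<in> Poly_Mapping.keys m"
  shows "m - dvar_monom v + dvar_monom w = dvar_monom z \<longleftrightarrow> m = dvar_monom v \<and> w = z"
proof
  assume eq: "m - dvar_monom v + dvar_monom w = dvar_monom z"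
  have lk: "Poly_Mapping.lookup m x - (1 when v = x) + (1 when w = x) = (1 when z = x)" for x
    using arg_cong[OF eq, of "\<lambda>p. Poly_Mapping.lookup p x"]
    by (simp add: lookup_add lookup_minus dvar_monom_def lookup_single)
  have wz: "w = z" using lk[of w] by (auto simp: when_def split: if_splits)
  have "Poly_Mapping.lookup m x = (1 when v = x)" for x
    using lk[of x] assms wz by (auto simp: when_def in_keys_iff split: if_splits)
  then have "m = dvar_monom v"
    by (intro poly_mapping_eqI) (simp add: dvar_monom_def lookup_single)
  with wz show "m = dvar_monom v \<and> w = z" by simp
qed simp

lemma lookup_dderiv_term_dvar_monom_Suc:
  "Poly_Mapping.lookup (dderiv_term \<delta> m c) (dvar_monom (j, Suc k)) =
     (\<delta> c when m = dvar_monom (j, Suc k)) + (c when m = dvar_monom (j, k))"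
proof -
  \<comment> \<open>Only the factor \<open>(j, k)\<close> can be moved to \<open>(j, Suc k)\<close>;
    in a linear \<open>m\<close> its exponent is 1, so the \<open>of_nat\<close> factor is 1 in
    every characteristic.\<close>
  have "Poly_Mapping.lookup (\<Sum>v\<in>Poly_Mapping.keys m.
        Poly_Mapping.single (m - dvar_monom v + dvar_monom (fst v, Suc (snd v)))
          (of_nat (Poly_Mapping.lookup m v) * c)) (dvar_monom (j, Suc k)) =
      (\<Sum>v\<in>Poly_Mapping.keys m. if v = (j, k) then (c when m = dvar_monom (j, k)) else 0)"
    unfolding lookup_sum
  proof (rule sum.cong[OF refl])
    fix v assume v: "v \<in> Poly_Mapping.keys m"
    show "Poly_Mapping.lookup (Poly_Mapping.single (m - dvar_monom v + dvar_monom (fst v, Suc (snd v)))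
          (of_nat (Poly_Mapping.lookup m v) * c)) (dvar_monom (j, Suc k)) =
        (if v = (j, k) then (c when m = dvar_monom (j, k)) else 0)"
      unfolding lookup_single monom_shift_eq_dvar_monom_iff[OF v]
      by (cases v) (auto simp: when_def dvar_monom_def)
  qed
  also have "\<dots> = (c when m = dvar_monom (j, k))"
    by (auto simp: when_def dvar_monom_def)
  finally show ?thesis
    by (simp add: dderiv_term_def lookup_add lookup_single case_prod_unfold)
qed

lemma lookup_dderiv_dvar_monom_Suc:
  assumes "derivation \<delta>"
  shows "Poly_Mapping.lookup (dderiv \<delta> p) (dvar_monom (j, Suc k)) =
    \<delta> (Poly_Mapping.lookup p (dvar_monom (j, Suc k))) + Poly_Mapping.lookup p (dvar_monom (j, k))"
proof -
  have "\<delta> (Poly_Mapping.lookup p m) = 0" if "m \<notin> Poly_Mapping.keys p" for m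
    using that derivation_0[OF assms] by (simp add: in_keys_iff)
  then show ?thesis
    by (auto simp: dderiv_def lookup_sum lookup_dderiv_term_dvar_monom_Suc sum.distrib when_def
        in_keys_iff)
qed

text \<open>By the recurrence, a column \<open>m + d + 1\<close> that is zero in rows up to
  \<open>d + 1\<close> forces column \<open>m + d\<close> to be zero in rows up to \<open>d\<close>.
  Row \<open>t = d\<close> alone may fail: for \<open>d = 1\<close> its entry is the coefficient at
  \<open>m\<close> plus the derivative of the one at \<open>m + 1\<close>, which can cancel.\<close>

lemma ex_lookup_dderiv_funpow_neq_0:
  assumes \<delta>: "derivation \<delta>"
    and nz: "Poly_Mapping.lookup p (dvar_monom (j, m)) \<noteq> 0"
  shows "\<exists>t\<le>d. Poly_Mapping.lookup ((dderiv \<delta> ^^ t) p) (dvar_monom (j, m + d)) \<noteq> 0"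
  using nz
proof (induction d arbitrary: m p)
  case (Suc d)
  show ?case
  proof (rule ccontr)
    assume "\<not> ?thesis"
    then have z: "Poly_Mapping.lookup ((dderiv \<delta> ^^ t) p) (dvar_monom (j, Suc (m + d))) = 0"
      if "t \<le> Suc d" for t using that by simp
    have "Poly_Mapping.lookup ((dderiv \<delta> ^^ t) p) (dvar_monom (j, m + d)) = 0" if "t \<le> d" for t
      using z[of t] z[of "Suc t"] that
      by (simp add: lookup_dderiv_dvar_monom_Suc[OF \<delta>] derivation_0[OF \<delta>])
    with Suc.IH[OF Suc.prems] show False by blast
  qed
qed simp

lemma dderiv_funpow_dvar: "derivation \<delta> \<Longrightarrow> (dderiv \<delta> ^^ k) (dvar j i) = dvar j (i + k)"
  by (induction k) (simp_all add: dderiv_dvar)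

lemma lookup_op_apply_dvar:
  assumes "derivation \<delta>"
  shows "Poly_Mapping.lookup (op_apply \<delta> P (dvar j 0)) m =
    (\<Sum>k\<le>Polynomial.degree P. poly.coeff P k when dvar_monom (j, k) = m)"
  unfolding op_apply_def dderiv_funpow_dvar[OF assms]
  by (simp add: lookup_sum dconst_def dvar_def mult_single lookup_single)

lemma lookup_sys_poly_dvar_monom:
  assumes "derivation \<delta>" and "j \<in> {1..n-1}"
  shows "Poly_Mapping.lookup (sys_poly \<delta> n a L i) (dvar_monom (j, k)) = poly.coeff (L i j) k"
proof -
  have "Poly_Mapping.lookup (op_apply \<delta> (L i j') (dvar j' 0)) (dvar_monom (j, k)) =
      (if j' = j then poly.coeff (L i j) k else 0)" for j'
    by (auto simp: lookup_op_apply_dvar[OF assms(1)] dvar_monom_eq_iff when_def coeff_eq_0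
        intro: sum.neutral)
  then show ?thesis
    using assms(2) dvar_monom_neq_0[of "(j, k)"]
    by (auto simp: sys_poly_def lookup_add lookup_sum dconst_def lookup_single when_def)
qed

lemma lookup_sys_poly_0:
  "derivation \<delta> \<Longrightarrow> Poly_Mapping.lookup (sys_poly \<delta> n a L i) 0 = a i"
  by (simp add: sys_poly_def lookup_add lookup_sum lookup_op_apply_dvar dvar_monom_neq_0
      dconst_def)

lemma super_essential_matching:
  assumes "super_essential n L" and "i \<in> {1..n}"
  obtains \<sigma> where "bij_betw \<sigma> ({1..n} - {i}) {1..n-1}"
    and "\<And>h. h \<in> {1..n} - {i} \<Longrightarrow> L h (\<sigma> h) \<noteq> 0"
proof -
  obtain \<tau> where \<tau>: "\<tau> permutes {1..n-1}"
    and lo: "\<forall>j\<in>{1..<i}. L j (\<tau> (n - j)) \<noteq> 0"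
    and hi: "\<forall>j\<in>{i<..n}. L j (\<tau> (n - j + 1)) \<noteq> 0"
    using assms unfolding super_essential_def by blast
  \<comment> \<open>Numbers the rows other than \<open>i\<close> backwards by \<open>1..n-1\<close>,
    which unites the two index shifts of \<open>super_essential\<close> in one bijection.\<close>
  define \<rho> where "\<rho> h = (if h < i then n - h else n - h + 1)" for h
  have "bij_betw \<rho> ({1..n} - {i}) {1..n-1}"
    by (rule bij_betw_byWitness[where f' = "\<lambda>k. if n - k < i then n - k else n - k + 1"])
      (use assms(2) in \<open>auto simp: \<rho>_def split: if_splits\<close>)
  then have "bij_betw (\<tau> \<circ> \<rho>) ({1..n} - {i}) {1..n-1}"
    using permutes_imp_bij[OF \<tau>] by (rule bij_betw_trans)
  moreover have "L h ((\<tau> \<circ> \<rho>) h) \<noteq> 0" if "h \<in> {1..n} - {i}" for h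
    using that lo hi by (auto simp: \<rho>_def)
  ultimately show ?thesis by (rule that)
qed

text \<open>Along a matching that omits row \<open>i\<close>, the differences \<open>?d\<close> are
  nonnegative by \<open>gamma_at_le\<close>, and their sum is the right-hand side; hence each single
  one is bounded by it.\<close>

lemma super_essential_partner:
  assumes se: "super_essential n L" and i: "i \<in> {1..n}" and j: "j \<in> {1..n-1}"
  obtains h where "h \<in> {1..n}" "L h j \<noteq> 0"
    and "sys_order \<delta> n a L h - gamma_at \<delta> n a L j
      \<le> sum_orders \<delta> n a L - sys_order \<delta> n a L i - gamma \<delta> n a L"
proof -
  obtain \<sigma> where \<sigma>: "bij_betw \<sigma> ({1..n} - {i}) {1..n-1}"
    and nz: "\<And>h. h \<in> {1..n} - {i} \<Longrightarrow> L h (\<sigma> h) \<noteq> 0"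
    using super_essential_matching[OF se i] by blast
  obtain h where h: "h \<in> {1..n} - {i}" "\<sigma> h = j"
    using \<sigma> j by (metis bij_betw_imp_surj_on imageE)
  let ?d = "\<lambda>h. sys_order \<delta> n a L h - gamma_at \<delta> n a L (\<sigma> h)"
  have "?d h \<le> (\<Sum>h\<in>{1..n} - {i}. ?d h)"
    using h(1) nz by (intro member_le_sum) (auto intro!: gamma_at_le)
  also have "\<dots> = sum_orders \<delta> n a L - sys_order \<delta> n a L i - gamma \<delta> n a L"
    using sum.reindex_bij_betw[OF \<sigma>, of "gamma_at \<delta> n a L"] i
    by (simp add: sum_subtractf sum_orders_def gamma_def sum_diff1)
  finally show ?thesis using that[of h] h nz[of h] by simp
qed

text \<open>Ensures that each underived polynomial of the system is a row, as the constant column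
  requires.\<close>

lemma super_essential_nonneg:
  assumes "super_essential n L" and "n \<ge> 2" and "i \<in> {1..n}"
  shows "0 \<le> sum_orders \<delta> n a L - sys_order \<delta> n a L i - gamma \<delta> n a L"
proof -
  have "1 \<in> {1..n-1}" using assms(2) by auto
  then obtain h where "h \<in> {1..n}" "L h 1 \<noteq> 0"
    and "sys_order \<delta> n a L h - gamma_at \<delta> n a L 1
      \<le> sum_orders \<delta> n a L - sys_order \<delta> n a L i - gamma \<delta> n a L"
    using super_essential_partner[OF assms(1,3)] by blast
  with gamma_at_le[of L h 1 n \<delta> a] show ?thesis by simp
qed

lemma coeff_ldeg_neq_0: "P \<noteq> 0 \<Longrightarrow> poly.coeff P (ldeg P) \<noteq> 0"
  unfolding ldeg_def by (rule LeastI[of _ "Polynomial.degree P"]) (simp add: leading_coeff_neq_0)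

lemma ldeg_le_degree: "P \<noteq> 0 \<Longrightarrow> ldeg P \<le> Polynomial.degree P"
  unfolding ldeg_def by (rule Least_le) (simp add: leading_coeff_neq_0)

lemma gamma_lower_le: "L i j \<noteq> 0 \<Longrightarrow> i \<in> {1..n} \<Longrightarrow> gamma_lower n L j \<le> int (ldeg (L i j))"
  unfolding gamma_lower_def by (intro Min_le) auto

lemma gamma_upper_le:
  "L i j \<noteq> 0 \<Longrightarrow> i \<in> {1..n} \<Longrightarrow>
    gamma_upper \<delta> n a L j \<le> sys_order \<delta> n a L i - int (Polynomial.degree (L i j))"
  unfolding gamma_upper_def by (intro Min_le) auto

lemma gamma_lower_attained:
  assumes "\<exists>i\<in>{1..n}. L i j \<noteq> 0"
  obtains i where "i \<in> {1..n}" "L i j \<noteq> 0" "gamma_lower n L j = int (ldeg (L i j))"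
proof -
  have "gamma_lower n L j \<in> {int (ldeg (L i j)) | i. L i j \<noteq> 0 \<and> i \<in> {1..n}}"
    unfolding gamma_lower_def using assms by (intro Min_in) auto
  then show ?thesis using that by blast
qed

lemma gamma_upper_attained:
  assumes "\<exists>i\<in>{1..n}. L i j \<noteq> 0"
  obtains i where "i \<in> {1..n}" "L i j \<noteq> 0"
    "gamma_upper \<delta> n a L j = sys_order \<delta> n a L i - int (Polynomial.degree (L i j))"
proof -
  have "gamma_upper \<delta> n a L j \<in>
      {sys_order \<delta> n a L i - int (Polynomial.degree (L i j)) | i. L i j \<noteq> 0 \<and> i \<in> {1..n}}"
    unfolding gamma_upper_def using assms by (intro Min_in) auto
  then show ?thesis using that by blast
qed

lemma super_essential_column_covered:
  assumes se: "super_essential n L" and j: "j \<in> {1..n-1}"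
    and ex: "\<exists>i\<in>{1..n}. L i j \<noteq> 0"
    and k: "gamma_lower n L j \<le> k" "k \<le> sum_orders \<delta> n a L - gamma_upper \<delta> n a L j - gamma \<delta> n a L"
  shows "\<exists>i\<in>{1..n}. \<exists>m. poly.coeff (L i j) m \<noteq> 0 \<and> int m \<le> k \<and>
    k \<le> int m + (sum_orders \<delta> n a L - sys_order \<delta> n a L i - gamma \<delta> n a L)"
proof (rule ccontr)
  let ?o = "sys_order \<delta> n a L" and ?d = "\<lambda>i. int (Polynomial.degree (L i j))"
  let ?T = "\<lambda>i. sum_orders \<delta> n a L - ?o i - gamma \<delta> n a L"
  let ?l = "gamma_lower n L j" and ?u = "gamma_upper \<delta> n a L j"
  assume "\<not> ?thesis"
  then have gap: "k < int m \<or> int m + ?T i < k" if "i \<in> {1..n}" "poly.coeff (L i j) m \<noteq> 0" for i m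
    using that by force
  have gapd: "k < ?d i \<or> ?d i + ?T i < k" if "i \<in> {1..n}" "L i j \<noteq> 0" for i
    using gap[of i "Polynomial.degree (L i j)"] that by simp
  have d: "?l \<le> ?d i" "?d i \<le> ?o i - ?u" if "i \<in> {1..n}" "L i j \<noteq> 0" for i
    using that ldeg_le_degree[of "L i j"] gamma_lower_le[of L i j n] gamma_upper_le[of L i j n \<delta> a]
    by auto
  obtain x where x: "x \<in> {1..n}" "L x j \<noteq> 0" "?l = int (ldeg (L x j))"
    using gamma_lower_attained[of n L j] ex by blast
  obtain y where y: "y \<in> {1..n}" "L y j \<noteq> 0" "?u = ?o y - ?d y"
    using gamma_upper_attained[of n L j] ex by blast
  obtain g where g: "g \<in> {1..n}" "L g j \<noteq> 0" "?o g - gamma_at \<delta> n a L j \<le> ?T x"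
    using super_essential_partner[OF se x(1) j] by blast
  obtain h where h: "h \<in> {1..n}" "L h j \<noteq> 0" "?o h - gamma_at \<delta> n a L j \<le> ?T y"
    using super_essential_partner[OF se y(1) j] by blast
  \<comment> \<open>The rows of \<open>x\<close> start at the lowest column \<open>?l\<close>, so
    \<open>k\<close> can only lie beyond them.\<close>
  have "?l + ?T x < k" using gap[OF x(1) coeff_ldeg_neq_0[OF x(2)]] x(3) k(1) by linarith
  \<comment> \<open>\<open>?d y + ?T y\<close> is exactly the upper bound on \<open>k\<close>, so
    \<open>k\<close> can only lie before \<open>?d y\<close>.\<close>
  moreover have "k < ?d y" using gapd[OF y(1,2)] y(3) k(2) by linarith
  \<comment> \<open>From \<open>?d g \<le> ?o g - ?u \<le> ?l + ?T x < k\<close> it follows that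
    \<open>?d g + ?T g < k\<close>, and \<open>k < ?d y = ?o y - ?u\<close> yields
    \<open>?o g < ?o y\<close>. The bound on \<open>h\<close> is symmetric in \<open>h\<close> and
    \<open>y\<close>, so \<open>?d h + ?T h \<ge> ?d y > k\<close> and thus \<open>k < ?d h\<close>.
    Then \<open>?l + ?T g < k < ?o h - ?u \<le> ?l + ?T y\<close> yields
    \<open>?o y < ?o g\<close>.\<close>
  ultimately show False
    using gapd[OF g(1,2)] gapd[OF h(1,2)] d[OF g(1,2)] d[OF h(1,2)] g(3) h(3) y(3)
    unfolding gamma_at_def by linarith
qed

lemma dderiv_funpow_in_ps_list:
  assumes "i \<in> {1..n}" and "int t \<le> sum_orders \<delta> n a L - sys_order \<delta> n a L i - gamma \<delta> n a L"
  shows "(dderiv \<delta> ^^ t) (sys_poly \<delta> n a L i) \<in> set (ps_list \<delta> n a L)"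
  unfolding ps_list_def set_concat set_map image_image set_upt set_upto
  using assms by (intro UN_I[of i] image_eqI[of _ _ "int t"]) auto

theorem theorem3p8:
  fixes \<delta> :: "'a::idom \<Rightarrow> 'a"
    and n :: nat
    and a :: "nat \<Rightarrow> 'a"
    and L :: "nat \<Rightarrow> nat \<Rightarrow> 'a poly"
  assumes "derivation \<delta>"
    and "n \<ge> 2"
    and P1: "\<forall>i\<in>{1..n}. sys_order \<delta> n a L i \<ge> 0"
    and P2: "inj_on (sys_poly \<delta> n a L) {1..n}"
    and P3: "\<exists>i\<in>{1..n}. a i \<noteq> 0"
    and P4: "\<forall>j\<in>{1..n-1}. \<exists>i\<in>{1..n}. L i j \<noteq> 0"
    and "super_essential n L"
  shows "\<forall>c < dim_col (M_mat \<delta> n a L). col (M_mat \<delta> n a L) c \<noteq> 0\<^sub>v (dim_row (M_mat \<delta> n a L))"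
proof (intro allI impI)
  fix c assume "c < dim_col (M_mat \<delta> n a L)"
  then have c: "c < length (M_cols \<delta> n a L)" by (simp add: M_mat_def)
  let ?m = "M_cols \<delta> n a L ! c"
  have "\<exists>p\<in>set (ps_list \<delta> n a L). Poly_Mapping.lookup p ?m \<noteq> 0"
  proof (cases "?m = 0")
    case True
    obtain i where i: "i \<in> {1..n}" "a i \<noteq> 0" using P3 by blast
    have "sys_poly \<delta> n a L i \<in> set (ps_list \<delta> n a L)"
      using dderiv_funpow_in_ps_list[OF i(1), of 0 \<delta> a L]
        super_essential_nonneg[OF \<open>super_essential n L\<close> \<open>n \<ge> 2\<close> i(1)] by simp
    then show ?thesis
      using True i(2) lookup_sys_poly_0[OF \<open>derivation \<delta>\<close>] by metis
  next
    case False
    with nth_mem[OF c] have "?m \<in> dvar_monom ` set (var_list \<delta> n a L)"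
      by (simp add: M_cols_def)
    then obtain j k where "1 \<le> j" "j < n" and m: "?m = dvar_monom (j, nat k)"
      and k: "gamma_lower n L j \<le> k"
        "k \<le> sum_orders \<delta> n a L - gamma_upper \<delta> n a L j - gamma \<delta> n a L"
      unfolding var_list_def set_concat set_map set_upt set_upto by fastforce
    then have j: "j \<in> {1..n-1}" by simp
    obtain i l where i: "i \<in> {1..n}" and l: "poly.coeff (L i j) l \<noteq> 0" "int l \<le> k"
      and kl: "k \<le> int l + (sum_orders \<delta> n a L - sys_order \<delta> n a L i - gamma \<delta> n a L)"
      using super_essential_column_covered[OF \<open>super_essential n L\<close> j P4[rule_format, OF j] k]
      by blast
    \<comment> \<open>Since \<open>0 \<le> int l \<le> k\<close>, both \<open>nat k\<close> and the
      truncated difference are exact; the latter is at most the largest derivation order listed for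
      row \<open>i\<close>.\<close>
    obtain t where t: "t \<le> nat k - l"
      and nz: "Poly_Mapping.lookup ((dderiv \<delta> ^^ t) (sys_poly \<delta> n a L i))
        (dvar_monom (j, l + (nat k - l))) \<noteq> 0"
      using ex_lookup_dderiv_funpow_neq_0[OF \<open>derivation \<delta>\<close>] l(1)
        lookup_sys_poly_dvar_monom[OF \<open>derivation \<delta>\<close> j] by metis
    have "(dderiv \<delta> ^^ t) (sys_poly \<delta> n a L i) \<in> set (ps_list \<delta> n a L)"
      using t l(2) kl by (intro dderiv_funpow_in_ps_list i) linarith
    moreover have "l + (nat k - l) = nat k" using l(2) by linarith
    ultimately show ?thesis using nz m by auto
  qed
  then obtain r where r: "r < length (ps_list \<delta> n a L)"
    and nz: "Poly_Mapping.lookup (ps_list \<delta> n a L ! r) ?m \<noteq> 0"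
    by (metis in_set_conv_nth)
  have "col (M_mat \<delta> n a L) c $ r \<noteq> 0" using r c nz by (simp add: M_mat_def)
  moreover have "0\<^sub>v (dim_row (M_mat \<delta> n a L)) $ r = 0" using r by (simp add: M_mat_def)
  ultimately show "col (M_mat \<delta> n a L) c \<noteq> 0\<^sub>v (dim_row (M_mat \<delta> n a L))" by metis
qed

end
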